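(* For partitions $\lambda,\mu\vdash n$, the dual Murnaghan–Nakayama rule for the irreducible characters of the Iwahori–Hecke algebra of type $A$ is $$ \chi^{\lambda}_{\mu}(q) =\sum_{\tau\in \mathscr C_{\mu}}q^{\lambda_1-\ell(\tau)} \sum_{\mathfrak b\in\mathscr{B}_{|\tau|-\lambda_1}}(q-1)^{\ell(\tau)-\ell(\mu)+\ell(\mu-\tau)+\ell(\mathfrak b)} \prod_{j=1}^{\ell(\mathfrak b)}\frac{1}{q^{-r_j(\mathfrak b)}-1}\;\chi^{\lambda^{[1]}}_{(\mu-\tau)\cup\mathfrak b}(q), $$ where $(\mu-\tau)\cup\mathfrak b$ denotes the partition obtained by rearranging the nonzero parts of $\mu-\tau$ together with the brick lengths of $\mathfrak b$.
   Context: Hecke algebra: for a fixed complex parameter $q$, $H_n(q)$ is the unital associative algebra generated by $T_1,\ldots,T_{n-1}$ with relations $T_iT_j=T_jT_i$ if $|i-j|\ge 2$, $T_iT_{i+1}T_i=T_{i+1}T_iT_{i+1}$, and $T_i^2=(q-1)T_i+q$. For $w$ in the symmetric group with reduced expression $w=s_{i_1}\cdots s_{i_k}$ in the simple transpositions, $T_w=T_{i_1}\cdots T_{i_k}$ (independent of the choice of reduced expression). Standard elements: for a partition $\mu=(\mu_1,\ldots,\mu_s)$ of $n$, $T_{\gamma_\mu}=T_{\sigma_{\mu_1}}\cdots T_{\sigma_{\mu_s}}$, where $T_{\sigma_{\mu_i}}$ is the element attached to the cyclic permutation of the consecutive indices $a+1,a+2,\ldots,a+\mu_i$ with $a=\mu_1+\cdots+\mu_{i-1}$.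 Characters: the complex irreducible representations of $H_n(q)$ are labeled by partitions $\lambda$ of $n$; $\chi^\lambda$ is the trace of the one labeled by $\lambda$, and $\chi^\lambda_\mu(q)$ is its value on $T_{\gamma_\mu}$. The labeling is the one of Ram's Frobenius formula: for each partition $\mu$ of $n$, $$\frac{q^{n}}{(q-1)^{\ell(\mu)}}\,q_\mu(x;q^{-1})=\sum_{\lambda\vdash n}\chi^\lambda_\mu(q)\,s_\lambda(x),$$ where $s_\lambda$ are the Schur functions, $q_\mu(x;t)=\prod_i q_{\mu_i}(x;t)$, and $\sum_{k\ge0}q_k(x;t)z^k=\exp\left(\sum_{k\ge1}\frac{1-t^k}{k}p_k z^k\right)$ with $p_k$ the power sums. Partitions: $\ell(\mu)$ is the number of (nonzero) parts of $\mu$. For $\lambda=(\lambda_1,\lambda_2,\ldots,\lambda_\ell)$, $\lambda^{[i]}=(\lambda_{i+1},\lambda_{i+2},\ldots,\lambda_\ell)$ for $1\le i\le \ell-1$; in particular $\lambda^{[1]}$ is $\lambda$ with its first part removed. Index sets: for $\mu=(\mu_1,\ldots,\mu_s)$, $\mathscr C_\mu=\{\tau=(\tau_1,\ldots,\tau_s)\in\mathbb Z_{\ge0}^s : 0\le\tau_i\le\mu_i \text{ for all } i\}$; $|\tau|=\sum_i\tau_i$, $\mu-\tau=(\mu_1-\tau_1,\ldots,\mu_s-\tau_s)$, and $\ell(\tau)$, $\ell(\mu-\tau)$ denote the numbers of nonzero entries. Brick tabloids: a brick tabloid of $m$ is a row of $m$ boxes formed as the disjoint union of consecutive bricks, i.e.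 an ordered sequence $\mathfrak b=(b_1,b_2,\ldots)$ of brick lengths with $\sum_i b_i=m$. $\ell(\mathfrak b)$ is the number of bricks and $r_i(\mathfrak b)=\sum_{j\le i}b_j$ is the number of boxes in the first $i$ bricks. $\mathscr B_m$ is the set of all brick tabloids of $m$; $\mathscr B_0=\{\varnothing\}$ with $\ell(\varnothing)=0$ (so the product is $1$), and $\mathscr B_m$ is empty for $m<0$. *)

theory Defs
  imports
    "HOL-Library.Poly_Mapping"
    "HOL-Library.More_List"
    "HOL-Combinatorics.Cycles"
    "HOL-Computational_Algebra.Formal_Power_Series"
    "HOL-Algebra.QuotRing"
    "Jordan_Normal_Form.VS_Connect"
    Complex_Main
begin

section \<open>Partitions, brick tabloids and index sets\<close>

text \<open>Partitions are weakly decreasing lists of positive integers; the first part of the empty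
  partition is read as 0 (via \<^const>\<open>nth_default\<close>).\<close>

definition is_partition :: "nat list \<Rightarrow> nat \<Rightarrow> bool" where
  "is_partition lam n \<longleftrightarrow> sorted_wrt (\<ge>) lam \<and> 0 \<notin> set lam \<and> sum_list lam = n"

definition partition_of_parts :: "nat list \<Rightarrow> nat list" where
  "partition_of_parts xs = rev (sort (filter (\<lambda>k. k \<noteq> 0) xs))"

definition num_nonzero :: "nat list \<Rightarrow> nat" where
  "num_nonzero xs = length (filter (\<lambda>k. k \<noteq> 0) xs)"

definition index_set :: "nat list \<Rightarrow> nat list set" where
  "index_set mu = {tau. length tau = length mu \<and> (\<forall>i<length mu. tau ! i \<le> mu ! i)}"

definition comp_diff :: "nat list \<Rightarrow> nat list \<Rightarrow> nat list" where
  "comp_diff mu tau = map2 (-) mu tau"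

definition brick_tabloids :: "int \<Rightarrow> nat list set" where
  "brick_tabloids m = {b. 0 \<notin> set b \<and> int (sum_list b) = m}"

definition brick_sum :: "nat list \<Rightarrow> nat \<Rightarrow> nat" where
  "brick_sum b i = sum_list (take i b)"


section \<open>The Hecke algebra\<close>

text \<open>Words in the letters \<open>1, 2, \<dots>\<close>, written additively so that finitely supported functions
  on words, with the convolution product of \<^theory>\<open>HOL-Library.Poly_Mapping\<close>, form the free
  associative algebra.\<close>

datatype gword = GWord (letters: "nat list")

instantiation gword :: monoid_add
begin

definition zero_gword :: gword where "0 = GWord []"

definition plus_gword :: "gword \<Rightarrow> gword \<Rightarrow> gword" where
  "u + v = GWord (letters u @ letters v)"

instance
  by standard (auto simp: zero_gword_def plus_gword_def)

end

type_synonym free_elem = "gword \<Rightarrow>\<^sub>0 complex"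
type_synonym hecke_elem = "free_elem set"

definition free_algebra :: "nat \<Rightarrow> free_elem ring" where
  "free_algebra n =
    \<lparr>carrier = {f. \<forall>w \<in> Poly_Mapping.keys f. set (letters w) \<subseteq> {1..<n}},
     mult = (*), one = 1, zero = 0, add = (+)\<rparr>"

definition gen :: "nat \<Rightarrow> free_elem" where
  "gen i = Poly_Mapping.single (GWord [i]) 1"

definition scal :: "complex \<Rightarrow> free_elem" where
  "scal c = Poly_Mapping.single 0 c"

definition hecke_relators :: "nat \<Rightarrow> complex \<Rightarrow> free_elem set" where
  "hecke_relators n q =
     {gen i * gen j - gen j * gen i | i j.
        i \<in> {1..<n} \<and> j \<in> {1..<n} \<and> (i + 2 \<le> j \<or> j + 2 \<le> i)}
   \<union> {gen i * gen (i+1) * gen i - gen (i+1) * gen i * gen (i+1) | i.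
        i \<in> {1..<n} \<and> i + 1 \<in> {1..<n}}
   \<union> {gen i * gen i - (scal (q - 1) * gen i + scal q) | i. i \<in> {1..<n}}"

definition hecke_ideal :: "nat \<Rightarrow> complex \<Rightarrow> free_elem set" where
  "hecke_ideal n q = genideal (free_algebra n) (hecke_relators n q)"

definition hecke :: "nat \<Rightarrow> complex \<Rightarrow> hecke_elem ring" where
  "hecke n q = free_algebra n Quot hecke_ideal n q"

definition hecke_class :: "nat \<Rightarrow> complex \<Rightarrow> free_elem \<Rightarrow> hecke_elem" where
  "hecke_class n q f = hecke_ideal n q +>\<^bsub>free_algebra n\<^esub> f"

definition perm_of_word :: "nat list \<Rightarrow> nat \<Rightarrow> nat" where
  "perm_of_word is = foldr (\<lambda>i w. transpose i (i + 1) \<circ> w) is id"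

definition reduced_word :: "nat \<Rightarrow> (nat \<Rightarrow> nat) \<Rightarrow> nat list \<Rightarrow> bool" where
  "reduced_word n w is \<longleftrightarrow> set is \<subseteq> {1..<n} \<and> perm_of_word is = w \<and>
     (\<forall>js. set js \<subseteq> {1..<n} \<and> perm_of_word js = w \<longrightarrow> length is \<le> length js)"

definition hecke_T :: "nat \<Rightarrow> complex \<Rightarrow> (nat \<Rightarrow> nat) \<Rightarrow> hecke_elem" where
  "hecke_T n q w =
     foldr (\<lambda>i t. hecke_class n q (gen i) \<otimes>\<^bsub>hecke n q\<^esub> t) (SOME is. reduced_word n w is)
       \<one>\<^bsub>hecke n q\<^esub>"

text \<open>The list \<open>[a+1, \<dots>, a+m]\<close> is the cycle \<open>a+1 \<mapsto> a+2 \<mapsto> \<dots> \<mapsto> a+m \<mapsto> a+1\<close>.\<close>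

definition std_elem :: "nat \<Rightarrow> complex \<Rightarrow> nat list \<Rightarrow> hecke_elem" where
  "std_elem n q mu =
     foldr (\<lambda>i t. (let a = sum_list (take i mu)
                   in hecke_T n q (cycle_of_list [a + 1..<a + mu ! i + 1])) \<otimes>\<^bsub>hecke n q\<^esub> t)
       [0..<length mu] \<one>\<^bsub>hecke n q\<^esub>"


section \<open>Representations and characters\<close>

text \<open>A representation is a unital \<open>\<complex>\<close>-algebra homomorphism to the \<open>d \<times> d\<close> matrices;
  for a unital ring homomorphism, \<open>\<complex>\<close>-linearity amounts to scalars being sent to scalar
  matrices.\<close>

definition hecke_rep :: "nat \<Rightarrow> complex \<Rightarrow> nat \<Rightarrow> (hecke_elem \<Rightarrow> complex mat) \<Rightarrow> bool" where
  "hecke_rep n q d R \<longleftrightarrow>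
     R \<in> Ring.ring_hom (hecke n q) (ring_mat TYPE(complex) d ()) \<and>
     (\<forall>c. R (hecke_class n q (scal c)) = c \<cdot>\<^sub>m 1\<^sub>m d)"

definition hecke_irrep :: "nat \<Rightarrow> complex \<Rightarrow> nat \<Rightarrow> (hecke_elem \<Rightarrow> complex mat) \<Rightarrow> bool" where
  "hecke_irrep n q d R \<longleftrightarrow> hecke_rep n q d R \<and> d > 0 \<and>
     (\<forall>W. VectorSpace.subspace class_ring W (module_vec TYPE(complex) d) \<and>
          (\<forall>h \<in> carrier (hecke n q). \<forall>v \<in> W. R h *\<^sub>v v \<in> W) \<longrightarrow>
          W = {0\<^sub>v d} \<or> W = carrier_vec d)"

definition equiv_rep ::
  "nat \<Rightarrow> complex \<Rightarrow> (hecke_elem \<Rightarrow> complex mat) \<Rightarrow> (hecke_elem \<Rightarrow> complex mat) \<Rightarrow> bool" where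
  "equiv_rep n q R S \<longleftrightarrow>
     (\<exists>P Q. \<forall>h \<in> carrier (hecke n q). similar_mat_wit (R h) (S h) P Q)"

definition mat_trace :: "complex mat \<Rightarrow> complex" where
  "mat_trace A = (\<Sum>i<dim_row A. A $$ (i, i))"

text \<open>\<open>\<chi>\<^sup>\<lambda>\<^sub>\<mu>(q)\<close> for a family \<open>R\<close> of representations of \<open>H\<^sub>n(q)\<close> labeled by partitions of \<open>n\<close>.\<close>

definition hecke_char ::
  "nat \<Rightarrow> complex \<Rightarrow> (nat list \<Rightarrow> hecke_elem \<Rightarrow> complex mat) \<Rightarrow> nat list \<Rightarrow> nat list \<Rightarrow> complex"
where
  "hecke_char n q R lam mu = mat_trace (R lam (std_elem n q mu))"


section \<open>Symmetric functions\<close>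

text \<open>Symmetric functions are evaluated at points \<open>(x 0, \<dots>, x (N-1))\<close>; identities are required
  for every \<open>N\<close>.\<close>

definition power_sum :: "nat \<Rightarrow> (nat \<Rightarrow> complex) \<Rightarrow> nat \<Rightarrow> complex" where
  "power_sum N x k = (\<Sum>i<N. x i ^ k)"

text \<open>The inner series has constant term 0, since \<^term>\<open>1 - t ^ 0 = 0\<close>.\<close>

definition q_fun :: "nat \<Rightarrow> (nat \<Rightarrow> complex) \<Rightarrow> complex \<Rightarrow> nat \<Rightarrow> complex" where
  "q_fun N x t k = fps_nth
     (fps_compose (fps_exp 1) (Abs_fps (\<lambda>k. (1 - t ^ k) / of_nat k * power_sum N x k))) k"

definition q_fun_prod :: "nat \<Rightarrow> (nat \<Rightarrow> complex) \<Rightarrow> complex \<Rightarrow> nat list \<Rightarrow> complex" where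
  "q_fun_prod N x t mu = (\<Prod>k\<leftarrow>mu. q_fun N x t k)"

text \<open>Schur polynomials are ratios of alternants \<open>a\<^bsub>\<lambda>+\<delta>\<^esub> / a\<^sub>\<delta>\<close>. The quotient is meaningful only at
  points with pairwise distinct coordinates, where \<open>a\<^sub>\<delta>\<close> does not vanish; these are Zariski dense, so
  an identity of polynomials is determined there. With fewer variables than parts, the
  Schur polynomial is 0.\<close>

definition alternant :: "nat \<Rightarrow> (nat \<Rightarrow> nat) \<Rightarrow> (nat \<Rightarrow> complex) \<Rightarrow> complex" where
  "alternant N \<alpha> x = det (mat N N (\<lambda>(i, j). x i ^ \<alpha> j))"

definition schur :: "nat \<Rightarrow> nat list \<Rightarrow> (nat \<Rightarrow> complex) \<Rightarrow> complex" where
  "schur N lam x =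
     (if length lam \<le> N
      then alternant N (\<lambda>j. nth_default 0 lam j + (N - 1 - j)) x / alternant N (\<lambda>j. N - 1 - j) x
      else 0)"


section \<open>The labeling of the irreducible representations\<close>

definition frobenius_formula ::
  "nat \<Rightarrow> complex \<Rightarrow> (nat list \<Rightarrow> hecke_elem \<Rightarrow> complex mat) \<Rightarrow> bool" where
  "frobenius_formula n q R \<longleftrightarrow>
     (\<forall>mu. is_partition mu n \<longrightarrow>
       (\<forall>N x. inj_on x {..<N} \<longrightarrow>
          q ^ n / (q - 1) ^ length mu * q_fun_prod N x (inverse q) mu =
          (\<Sum>lam | is_partition lam n. hecke_char n q R lam mu * schur N lam x)))"

text \<open>The family \<open>R\<close> is a complete, irredundant list of the irreducible representations of
  \<open>H\<^sub>n(q)\<close> labeled by the partitions of \<open>n\<close>, the labels being those of Ram's Frobenius formula.\<close>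

definition irrep_labeling ::
  "nat \<Rightarrow> complex \<Rightarrow> (nat list \<Rightarrow> hecke_elem \<Rightarrow> complex mat) \<Rightarrow> bool" where
  "irrep_labeling n q R \<longleftrightarrow>
     (\<forall>lam. is_partition lam n \<longrightarrow> (\<exists>d. hecke_irrep n q d (R lam))) \<and>
     (\<forall>lam nu. is_partition lam n \<and> is_partition nu n \<and> equiv_rep n q (R lam) (R nu) \<longrightarrow> lam = nu) \<and>
     (\<forall>d S. hecke_irrep n q d S \<longrightarrow> (\<exists>lam. is_partition lam n \<and> equiv_rep n q S (R lam))) \<and>
     frobenius_formula n q R"

end

theory Submission
  imports Defs "HOL-Computational_Algebra.Polynomial_FPS"
begin

text \<open>Let \<open>t = 1/q\<close>. Multiplied by \<open>a\<^sub>\<delta>\<close>, Ram's Frobenius formula expands \<open>q\<^sub>\<mu> a\<^sub>\<delta>\<close> in alternants \<open>a\<^bsub>\<lambda>+\<delta>\<^esub>\<close>.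
  Take \<open>n + 1\<close> variables \<open>z, y\<^sub>1, \<dots>, y\<^sub>n\<close> and compare coefficients of \<open>z\<close> to the power \<open>\<lambda>\<^sub>1 + n\<close>. Since
  \<open>q\<^sub>\<mu>(z, y; t) = \<Sum>\<^sub>\<tau> (1 - t)\<close> to the \<open>\<ell>(\<tau>)\<close> times \<open>z\<close> to the \<open>|\<tau>|\<close> times \<open>q\<^bsub>\<mu>-\<tau>\<^esub>(y; t)\<close> and
  \<open>a\<^sub>\<delta>(z, y) = \<Prod>\<^sub>i (z - y\<^sub>i) a\<^sub>\<delta>(y)\<close>, the left-hand side yields the products
  \<open>q\<^bsub>\<mu>-\<tau>\<^esub>(y; t) f\<^sub>k(y) a\<^sub>\<delta>(y)\<close> with \<open>k = |\<tau>| - \<lambda>\<^sub>1\<close> and \<open>f\<^sub>k = (-1)\<^sup>k e\<^sub>k\<close>. Writing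
  \<open>E(z) = \<Sum> f\<^sub>k z\<^sup>k\<close> and \<open>Q(z) = \<Sum> q\<^sub>k z\<^sup>k\<close>, the identity \<open>E(t z) = Q(z) E(z)\<close> gives
  \<open>(t\<^sup>k - 1) f\<^sub>k = \<Sum>\<^bsub>j\<ge>1\<^esub> q\<^sub>j f\<^bsub>k-j\<^esub>\<close>, whose iteration is the sum over brick tabloids. The Frobenius formula
  for \<open>n - \<lambda>\<^sub>1\<close> turns the result into a combination of alternants in \<open>y\<close>, in which the alternant of
  \<open>\<lambda>\<^bsup>[1]\<^esup>\<close> carries the asserted sum. On the right-hand side, the expansion along the
  row of \<open>z\<close> produces the alternant of \<open>\<lambda>\<^bsup>[1]\<^esup>\<close> only from \<open>\<lambda>\<close> itself.\<close>

section \<open>Alternants\<close>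

text \<open>The increasing enumeration of the indices other than \<open>j\<close>; it numbers the
  columns that remain once column \<open>j\<close> is deleted.\<close>

definition skip_index :: "nat \<Rightarrow> nat \<Rightarrow> nat" where
  "skip_index j k = (if k < j then k else Suc k)"

lemma alternant_cong:
  assumes "\<And>i. i < N \<Longrightarrow> x i = y i" "\<And>j. j < N \<Longrightarrow> a j = b j"
  shows "alternant N a x = alternant N b y"
  unfolding alternant_def by (rule arg_cong[where f = det]) (auto intro!: eq_matI simp: assms)

lemma alternant_0 [simp]: "alternant 0 a x = 1"
  unfolding alternant_def by (rule det_dim_zero) auto

lemma alternant_expand:
  "alternant (Suc N) a x =
    (\<Sum>j\<le>N. (-1) ^ j * x 0 ^ a j * alternant N (a \<circ> skip_index j) (x \<circ> Suc))"
proof -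
  let ?A = "mat (Suc N) (Suc N) (\<lambda>(i, j). x i ^ a j)"
  have del: "mat_delete ?A 0 j = mat N N (\<lambda>(i, k). (x \<circ> Suc) i ^ (a \<circ> skip_index j) k)"
    if "j < Suc N" for j
    using that by (intro eq_matI) (auto simp: mat_delete_def skip_index_def)
  have "alternant (Suc N) a x = (\<Sum>j<Suc N. ?A $$ (0, j) * cofactor ?A 0 j)"
    unfolding alternant_def by (rule laplace_expansion_row) auto
  also have "\<dots> = (\<Sum>j<Suc N. (-1) ^ j * x 0 ^ a j * alternant N (a \<circ> skip_index j) (x \<circ> Suc))"
    by (intro sum.cong refl) (simp add: cofactor_def del alternant_def)
  finally show ?thesis by (simp only: lessThan_Suc_atMost)
qed

lemma alternant_eq_0_if_not_inj:
  assumes "\<not> inj_on x {..<N}"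
  shows "alternant N a x = 0"
proof -
  obtain i j where ij: "i < N" "j < N" "i \<noteq> j" "x i = x j"
    using assms by (auto simp: inj_on_def)
  show ?thesis
    unfolding alternant_def
    by (rule det_identical_rows[where i = i and j = j and n = N])
       (use ij in \<open>auto intro!: eq_vecI\<close>)
qed

section \<open>Alternants as polynomials in one variable; the Vandermonde determinant\<close>

text \<open>The Laplace expansion along the row of the first variable, read as a polynomial in that
  variable with \<open>y\<close> fixed, so that coefficients can be compared.\<close>

definition alternant_poly :: "nat \<Rightarrow> (nat \<Rightarrow> nat) \<Rightarrow> (nat \<Rightarrow> complex) \<Rightarrow> complex poly" where
  "alternant_poly N a y =
    (\<Sum>j\<le>N. Polynomial.monom ((-1) ^ j * alternant N (a \<circ> skip_index j) y) (a j))"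

lemma poly_alternant_poly: "poly (alternant_poly N a y) z = alternant (Suc N) a (case_nat z y)"
proof -
  have "case_nat z y \<circ> Suc = y" by auto
  then show ?thesis
    by (simp add: alternant_poly_def alternant_expand[where x = "case_nat z y"] poly_sum poly_monom mult_ac)
qed

lemma coeff_alternant_poly:
  "Polynomial.coeff (alternant_poly N a y) m =
    (\<Sum>j | j \<le> N \<and> a j = m. (-1) ^ j * alternant N (a \<circ> skip_index j) y)"
proof -
  have "Polynomial.coeff (alternant_poly N a y) m =
      (\<Sum>j\<le>N. if a j = m then (-1) ^ j * alternant N (a \<circ> skip_index j) y else 0)"
    by (simp add: alternant_poly_def Polynomial.coeff_sum)
  also have "\<dots> = (\<Sum>j | j \<in> {..N} \<and> a j = m. (-1) ^ j * alternant N (a \<circ> skip_index j) y)"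
    by (rule sum.inter_filter[symmetric]) simp
  finally show ?thesis by simp
qed

definition root_poly :: "nat \<Rightarrow> (nat \<Rightarrow> complex) \<Rightarrow> complex poly" where
  "root_poly N y = (\<Prod>i<N. [:- y i, 1:])"

lemma degree_root_poly: "Polynomial.degree (root_poly N y) = N"
  unfolding root_poly_def by (subst degree_prod_eq_sum_degree) auto

lemma lead_coeff_root_poly: "Polynomial.coeff (root_poly N y) N = 1"
proof -
  have "Polynomial.lead_coeff (root_poly N y) = 1"
    unfolding root_poly_def by (simp add: lead_coeff_prod)
  then show ?thesis by (simp add: degree_root_poly)
qed

lemma poly_root_poly: "poly (root_poly N y) z = (\<Prod>i<N. z - y i)"
  by (simp add: root_poly_def poly_prod)

text \<open>Both sides have degree at most \<open>N\<close> and the same coefficient at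
  \<open>N\<close>. If the \<open>y i\<close> are distinct, both vanish at these \<open>N\<close>
  points, the left one because two rows coincide; otherwise both are zero.\<close>

lemma vandermonde_poly:
  "alternant_poly N (\<lambda>j. N - j) y = Polynomial.smult (alternant N (\<lambda>j. N - 1 - j) y) (root_poly N y)"
    (is "?P = ?Q")
proof (cases "inj_on y {..<N}")
  case True
  have top: "Polynomial.coeff ?P N = Polynomial.coeff ?Q N"
  proof -
    \<comment> \<open>Only column 0 has exponent \<open>N\<close>; deleting it leaves the exponents
      \<open>N - 1 - j\<close>.\<close>
    have "{j. j \<le> N \<and> N - j = N} = {0}" by auto
    moreover have "(\<lambda>j. N - j) \<circ> skip_index 0 = (\<lambda>j. N - 1 - j)"
      by (auto simp: skip_index_def)
    ultimately show ?thesis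
      by (simp add: coeff_alternant_poly lead_coeff_root_poly)
  qed
  show ?thesis
  proof (rule poly_eqI_degree_lead_coeff[where A = "y ` {..<N}" and n = N])
    show "Polynomial.coeff ?P N = Polynomial.coeff ?Q N" by (rule top)
    show "N \<le> card (y ` {..<N})" using True by (simp add: card_image)
    show "Polynomial.degree ?P \<le> N"
      unfolding alternant_poly_def
      by (intro degree_sum_le) (auto intro: order_trans[OF degree_monom_le])
    show "Polynomial.degree ?Q \<le> N"
      using degree_smult_le[of _ "root_poly N y"] by (simp add: degree_root_poly)
    fix z assume "z \<in> y ` {..<N}"
    then obtain i where i: "i < N" "z = y i" by auto
    have "\<not> inj_on (case_nat z y) {..<Suc N}"
    proof
      assume "inj_on (case_nat z y) {..<Suc N}"
      from inj_onD[OF this, of 0 "Suc i"] i show False by simp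
    qed
    then have "poly ?P z = 0"
      by (subst poly_alternant_poly) (rule alternant_eq_0_if_not_inj)
    moreover have "poly ?Q z = 0" using i by (auto simp: poly_root_poly)
    ultimately show "poly ?P z = poly ?Q z" by simp
  qed
next
  case False
  have "poly ?P z = 0" for z
  proof -
    have "\<not> inj_on (case_nat z y) {..<Suc N}"
    proof
      assume inj: "inj_on (case_nat z y) {..<Suc N}"
      have "inj_on y {..<N}"
      proof (rule inj_onI)
        fix i j assume "i \<in> {..<N}" "j \<in> {..<N}" "y i = y j"
        then show "i = j" using inj_onD[OF inj, of "Suc i" "Suc j"] by simp
      qed
      with False show False by simp
    qed
    then show ?thesis by (subst poly_alternant_poly) (rule alternant_eq_0_if_not_inj)
  qed
  then have "?P = 0" using poly_all_0_iff_0 by blast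
  then show ?thesis using False by (simp add: alternant_eq_0_if_not_inj)
qed

text \<open>Splitting off \<open>x 0\<close> by \<open>vandermonde_poly\<close> produces the factors
  \<open>x 0 - x (Suc i)\<close>, which are nonzero for distinct coordinates.\<close>

lemma vandermonde_nonzero:
  "inj_on x {..<N} \<Longrightarrow> alternant N (\<lambda>j. N - 1 - j) x \<noteq> 0"
proof (induction N arbitrary: x)
  case (Suc N)
  have x: "x = case_nat (x 0) (x \<circ> Suc)" by (auto split: nat.split)
  have "inj_on (x \<circ> Suc) {..<N}"
    by (rule comp_inj_on) (auto intro: inj_on_subset[OF Suc.prems])
  then have "alternant N (\<lambda>j. N - 1 - j) (x \<circ> Suc) \<noteq> 0" by (rule Suc.IH)
  moreover have "x 0 \<noteq> x (Suc i)" if "i < N" for i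
    using inj_onD[OF Suc.prems, of 0 "Suc i"] that by auto
  moreover have "alternant (Suc N) (\<lambda>j. N - j) x =
      alternant N (\<lambda>j. N - 1 - j) (x \<circ> Suc) * (\<Prod>i<N. x 0 - x (Suc i))"
    using poly_alternant_poly[of N "\<lambda>j. N - j" "x \<circ> Suc" "x 0"] x
    by (simp add: vandermonde_poly poly_root_poly)
  ultimately show ?case by simp
qed simp

section \<open>Linear independence of alternants\<close>

text \<open>Comparing coefficients at the largest leading exponent \<open>M\<close>, as a power of the first variable,
  lowers the number of variables: in a decreasing list only the first entry can equal \<open>M\<close>.\<close>

lemma alternants_independent:
  assumes "finite S" "\<And>a. a \<in> S \<Longrightarrow> length a = N \<and> sorted_wrt (>) a"
    and "\<And>y. (\<Sum>a\<in>S. c a * alternant N ((!) a) y) = 0"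
    and "a \<in> S"
  shows "c a = 0"
  using assms
proof (induction N arbitrary: S c a)
  case 0
  have "S = {[]}" using 0(2,4) by auto
  then show ?case using 0(3,4) by simp
next
  case (Suc N)
  show ?case
  proof (rule ccontr)
    assume ca: "c a \<noteq> 0"
    \<comment> \<open>Terms with coefficient zero are discarded first, so that the coefficients at
      the leading exponent \<open>M\<close> chosen next are nonzero, which the induction hypothesis
      contradicts.\<close>
    define S' where "S' = {a \<in> S. c a \<noteq> 0}"
    have fin: "finite S'" using Suc.prems(1) by (simp add: S'_def)
    have ne: "S' \<noteq> {}" using ca Suc.prems(4) by (auto simp: S'_def)
    define M where "M = Max (hd ` S')"
    define S'' where "S'' = {a \<in> S'. hd a = M}"
    have M: "hd b \<le> M" if "b \<in> S'" for b using that fin by (auto simp: M_def)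
    have "M \<in> hd ` S'" unfolding M_def using fin ne by (intro Max_in) auto
    then obtain b where b: "b \<in> S''" by (auto simp: S''_def)
    have S'D: "\<exists>m b'. b = m # b' \<and> length b' = N \<and> sorted_wrt (>) b' \<and> (\<forall>k\<in>set b'. k < m) \<and> m \<le> M"
      if "b \<in> S'" for b
    proof -
      have "length b = Suc N" "sorted_wrt (>) b" using that Suc.prems(2) by (auto simp: S'_def)
      then show ?thesis using M[OF that] by (cases b) auto
    qed
    have S''D: "M # tl b = b" if "b \<in> S''" for b
    proof -
      have "b \<in> S'" "hd b = M" using that by (auto simp: S''_def)
      then show ?thesis using S'D[of b] by auto
    qed
    have inj: "inj_on tl S''"
    proof (rule inj_onI)
      fix u v assume "u \<in> S''" "v \<in> S''" "tl u = tl v"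
      then show "u = v" using S''D by metis
    qed
    have "(\<Sum>b\<in>tl ` S''. c (M # b) * alternant N ((!) b) y) = 0" for y
    proof -
      have "(\<Sum>b\<in>S'. Polynomial.smult (c b) (alternant_poly N ((!) b) y)) = 0" (is "?P = 0")
      proof -
        have "poly ?P z = 0" for z
        proof -
          have "poly ?P z = (\<Sum>b\<in>S'. c b * alternant (Suc N) ((!) b) (case_nat z y))"
            by (simp add: poly_sum poly_alternant_poly)
          also have "\<dots> = (\<Sum>b\<in>S. c b * alternant (Suc N) ((!) b) (case_nat z y))"
            by (rule sum.mono_neutral_left) (auto simp: S'_def Suc.prems(1))
          finally show ?thesis by (simp only: Suc.prems(3))
        qed
        then show ?thesis using poly_all_0_iff_0 by blast
      qed
      from arg_cong[OF this, of "\<lambda>p. Polynomial.coeff p M"]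
      have "0 = (\<Sum>b\<in>S'. c b * Polynomial.coeff (alternant_poly N ((!) b) y) M)"
        by (simp add: Polynomial.coeff_sum)
      also have "\<dots> = (\<Sum>b\<in>S'. if hd b = M then c b * alternant N ((!) (tl b)) y else 0)"
      proof (rule sum.cong[OF refl])
        fix b assume "b \<in> S'"
        then obtain m b' where b': "b = m # b'" "length b' = N" "\<forall>k\<in>set b'. k < m" "m \<le> M"
          using S'D by blast
        have lt: "(m # b') ! j < M" if j: "j \<le> N" "j \<noteq> 0" for j
        proof -
          obtain i where i: "j = Suc i" using j by (cases j) auto
          then have "b' ! i \<in> set b'" using j b'(2) by (intro nth_mem) simp
          then show ?thesis using b'(3,4) i by force
        qed
        have "j \<le> N \<and> (m # b') ! j = M \<longleftrightarrow> j = 0 \<and> m = M" for j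
          using lt[of j] by (cases "j = 0") auto
        then have "{j. j \<le> N \<and> (m # b') ! j = M} = (if m = M then {0} else {})" by simp
        moreover have "(!) (k # b') \<circ> skip_index 0 = (!) b'" for k
          by (auto simp: skip_index_def)
        ultimately show "c b * Polynomial.coeff (alternant_poly N ((!) b) y) M =
            (if hd b = M then c b * alternant N ((!) (tl b)) y else 0)"
          by (simp add: coeff_alternant_poly b')
      qed
      also have "\<dots> = (\<Sum>b\<in>S''. c b * alternant N ((!) (tl b)) y)"
        unfolding S''_def using fin by (simp add: sum.inter_filter)
      also have "\<dots> = (\<Sum>b\<in>S''. c (M # tl b) * alternant N ((!) (tl b)) y)"
      proof (rule sum.cong[OF refl])
        fix b assume "b \<in> S''"
        then have "M # tl b = b" by (rule S''D)
        then show "c b * alternant N ((!) (tl b)) y = c (M # tl b) * alternant N ((!) (tl b)) y"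
          by simp
      qed
      also have "\<dots> = (\<Sum>b\<in>tl ` S''. c (M # b) * alternant N ((!) b) y)"
        by (simp add: sum.reindex[OF inj])
      finally show ?thesis by simp
    qed
    moreover have "finite (tl ` S'')" using fin by (simp add: S''_def)
    moreover have "length b' = N \<and> sorted_wrt (>) b'" if "b' \<in> tl ` S''" for b'
    proof -
      obtain b where "b \<in> S'" "b' = tl b" using \<open>b' \<in> tl ` S''\<close> by (auto simp: S''_def)
      with S'D[of b] show ?thesis by auto
    qed
    ultimately have "c (M # tl b) = 0"
      using Suc.IH[of "tl ` S''" "\<lambda>b. c (M # b)" "tl b"] b by blast
    then have "c b = 0" by (simp only: S''D[OF b])
    then show False using b by (auto simp: S''_def S'_def)
  qed
qed

text \<open>Indices need not have distinct exponent lists, so linear independence is applied after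
  collecting the terms with equal lists.\<close>

lemma alternant_families_coeff_eq:
  assumes fin: "finite I" "finite J"
    and e: "\<And>i. i \<in> I \<Longrightarrow> length (e i) = N \<and> sorted_wrt (>) (e i)"
    and f: "\<And>j. j \<in> J \<Longrightarrow> length (f j) = N \<and> sorted_wrt (>) (f j)"
    and eq: "\<And>y. (\<Sum>i\<in>I. c i * alternant N ((!) (e i)) y) = (\<Sum>j\<in>J. d j * alternant N ((!) (f j)) y)"
  shows "(\<Sum>i | i \<in> I \<and> e i = a. c i) = (\<Sum>j | j \<in> J \<and> f j = a. d j)"
proof (cases "a \<in> e ` I \<union> f ` J")
  case True
  define S where "S = e ` I \<union> f ` J"
  define C where "C a = (\<Sum>i | i \<in> I \<and> e i = a. c i) - (\<Sum>j | j \<in> J \<and> f j = a. d j)" for a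
  have "(\<Sum>a\<in>S. C a * alternant N ((!) a) y) = 0" for y
  proof -
    have "(\<Sum>a\<in>S. (\<Sum>i | i \<in> I \<and> e i = a. c i) * alternant N ((!) a) y) =
        (\<Sum>a\<in>S. \<Sum>i | i \<in> I \<and> e i = a. c i * alternant N ((!) (e i)) y)"
      by (intro sum.cong refl) (simp add: sum_distrib_right)
    also have "\<dots> = (\<Sum>i\<in>I. c i * alternant N ((!) (e i)) y)"
      using fin by (intro sum.group) (auto simp: S_def)
    finally have 1: "(\<Sum>a\<in>S. (\<Sum>i | i \<in> I \<and> e i = a. c i) * alternant N ((!) a) y) =
        (\<Sum>i\<in>I. c i * alternant N ((!) (e i)) y)" .
    have "(\<Sum>a\<in>S. (\<Sum>j | j \<in> J \<and> f j = a. d j) * alternant N ((!) a) y) =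
        (\<Sum>a\<in>S. \<Sum>j | j \<in> J \<and> f j = a. d j * alternant N ((!) (f j)) y)"
      by (intro sum.cong refl) (simp add: sum_distrib_right)
    also have "\<dots> = (\<Sum>j\<in>J. d j * alternant N ((!) (f j)) y)"
      using fin by (intro sum.group) (auto simp: S_def)
    finally show ?thesis
      by (simp add: C_def left_diff_distrib sum_subtractf 1 eq)
  qed
  moreover have "length a = N \<and> sorted_wrt (>) a" if "a \<in> S" for a
    using that e f by (auto simp: S_def)
  ultimately have "C a = 0"
    using alternants_independent[of S N C a] fin True by (auto simp: S_def)
  then show ?thesis by (simp add: C_def)
next
  case False
  then have "{i. i \<in> I \<and> e i = a} = {}" "{j. j \<in> J \<and> f j = a} = {}" by auto
  then show ?thesis by (simp only: sum.empty)
qed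

section \<open>The functions \<open>q\<^sub>k\<close>\<close>

text \<open>The equation determines each coefficient of positive index from the earlier ones, since
  that index is invertible.\<close>

lemma fps_linear_ODE_unique:
  fixes F G :: "complex fps"
  assumes "fps_deriv F = C * F" "fps_deriv G = C * G" "fps_nth F 0 = fps_nth G 0"
  shows "F = G"
proof -
  have "fps_nth F n = fps_nth G n" for n
  proof (induction n rule: less_induct)
    case (less n)
    show ?case
    proof (cases n)
      case 0
      then show ?thesis using assms(3) by simp
    next
      case (Suc m)
      have "of_nat (Suc m) * fps_nth F (Suc m) = fps_nth (C * F) m"
        using arg_cong[OF assms(1), of "\<lambda>h. fps_nth h m"] by simp
      also have "\<dots> = fps_nth (C * G) m"
        unfolding fps_mult_nth using Suc by (intro sum.cong refl) (simp add: less.IH)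
      also have "\<dots> = of_nat (Suc m) * fps_nth G (Suc m)"
        using arg_cong[OF assms(2), of "\<lambda>h. fps_nth h m"] by simp
      finally show ?thesis using Suc by (simp del: of_nat_Suc)
    qed
  qed
  then show ?thesis by (simp add: fps_eq_iff)
qed

text \<open>Both sides solve \<open>F' = (A + B)' * F\<close> with constant term 1.\<close>

lemma fps_exp_compose_add:
  fixes A B :: "complex fps"
  assumes "fps_nth A 0 = 0" "fps_nth B 0 = 0"
  shows "fps_exp 1 oo (A + B) = (fps_exp 1 oo A) * (fps_exp 1 oo B)"
  by (rule fps_linear_ODE_unique[where C = "fps_deriv (A + B)"])
     (use assms in \<open>simp_all add: fps_compose_deriv algebra_simps\<close>)

abbreviation linear_fps :: "complex \<Rightarrow> complex fps" where
  "linear_fps c \<equiv> 1 - fps_const c * fps_X"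

lemma linear_fps_geometric: "linear_fps c * Abs_fps (\<lambda>k. c ^ k) = 1"
proof (rule fps_ext)
  fix n show "fps_nth (linear_fps c * Abs_fps (\<lambda>k. c ^ k)) n = fps_nth 1 n"
    by (cases n) (simp_all add: left_diff_distrib mult.assoc fps_X_mult_nth)
qed

text \<open>The logarithm of \<open>(1 - t c X) / (1 - c X)\<close>: what a single variable
  \<open>c\<close> contributes to the exponent in \<open>q_fun\<close>.\<close>

definition q_log :: "complex \<Rightarrow> complex \<Rightarrow> complex fps" where
  "q_log t c = Abs_fps (\<lambda>k. (1 - t ^ k) / of_nat k * c ^ k)"

lemma deriv_q_log:
  "fps_deriv (q_log t c) = fps_const c * Abs_fps (\<lambda>k. c ^ k) - fps_const (t * c) * Abs_fps (\<lambda>k. (t * c) ^ k)"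
proof (rule fps_ext)
  fix n
  have "(1 + of_nat n :: complex) \<noteq> 0" by (metis of_nat_Suc of_nat_neq_0)
  then show "fps_nth (fps_deriv (q_log t c)) n =
    fps_nth (fps_const c * Abs_fps (\<lambda>k. c ^ k) - fps_const (t * c) * Abs_fps (\<lambda>k. (t * c) ^ k)) n"
    by (simp add: q_log_def field_simps power_mult_distrib)
qed

text \<open>The quotient \<open>(1 - t c X) / (1 - c X)\<close> solves the same linear differential
  equation as the exponential, with the same constant term 1. The denominator is cleared in the
  statement.\<close>

lemma exp_q_log: "(fps_exp 1 oo q_log t c) * linear_fps c = linear_fps (t * c)"
proof -
  define D where "D = fps_deriv (q_log t c)"
  have 0: "fps_nth (q_log t c) 0 = 0" by (simp add: q_log_def)
  have "fps_exp 1 oo q_log t c = linear_fps (t * c) * Abs_fps (\<lambda>k. c ^ k)"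
  proof (rule fps_linear_ODE_unique[where C = D])
    show "fps_deriv (fps_exp 1 oo q_log t c) = D * (fps_exp 1 oo q_log t c)"
      by (simp add: fps_compose_deriv 0 D_def)
    define g h where "g = Abs_fps (\<lambda>k. c ^ k)" and "h = Abs_fps (\<lambda>k. (t * c) ^ k)"
    have gm: "linear_fps c * g = 1" and hm: "linear_fps (t * c) * h = 1"
      by (simp_all only: g_def h_def linear_fps_geometric)
    \<comment> \<open>Differentiating \<open>(1 - c X) g = 1\<close> and multiplying by
      \<open>g\<close> gives \<open>g' = c g g\<close>.\<close>
    have "fps_deriv (linear_fps c * g) = 0" by (simp only: gm) simp
    then have "linear_fps c * fps_deriv g = fps_const c * g"
      by (simp add: algebra_simps)
    then have "g * (linear_fps c * fps_deriv g) = g * (fps_const c * g)" by (simp only:)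
    then have "(linear_fps c * g) * fps_deriv g = fps_const c * g * g" by (simp only: mult_ac)
    then have dg: "fps_deriv g = fps_const c * g * g" by (simp only: gm mult_1_left)
    have D: "D = fps_const c * g - fps_const (t * c) * h"
      by (simp add: D_def deriv_q_log g_def h_def)
    \<comment> \<open>The trailing factor 1 is kept in order to be replaced by
      \<open>(1 - t c X) h\<close>, after which \<open>D\<close> can be factored out.\<close>
    have "fps_deriv (linear_fps (t * c) * g) = fps_const c * g * (linear_fps (t * c) * g) - fps_const (t * c) * g * 1"
      by (simp add: dg algebra_simps)
    also have "\<dots> = fps_const c * g * (linear_fps (t * c) * g) - fps_const (t * c) * g * (linear_fps (t * c) * h)"
      by (simp only: hm)
    also have "\<dots> = D * (linear_fps (t * c) * g)"
    proof -
      have "a * g * (L * g) - b * g * (L * h) = (a * g - b * h) * (L * g)" for a b L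
        by (simp add: algebra_simps)
      then show ?thesis by (simp only: D)
    qed
    finally show "fps_deriv (linear_fps (t * c) * Abs_fps (\<lambda>k. c ^ k)) =
        D * (linear_fps (t * c) * Abs_fps (\<lambda>k. c ^ k))" by (simp only: g_def)
  qed (simp add: 0)
  then have "(fps_exp 1 oo q_log t c) * linear_fps c =
      linear_fps (t * c) * (linear_fps c * Abs_fps (\<lambda>k. c ^ k))"
    by (simp only: mult_ac)
  then show ?thesis by (simp only: linear_fps_geometric mult_1_right)
qed

section \<open>The generating series of the \<open>q_fun\<close>\<close>

definition q_series :: "nat \<Rightarrow> (nat \<Rightarrow> complex) \<Rightarrow> complex \<Rightarrow> complex fps" where
  "q_series N x t = Abs_fps (q_fun N x t)"

lemma q_series_eq: "q_series N x t =
    fps_exp 1 oo Abs_fps (\<lambda>k. (1 - t ^ k) / of_nat k * power_sum N x k)"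
  by (rule fps_ext) (simp add: q_series_def q_fun_def)

lemma q_series_0: "q_series 0 x t = 1"
proof -
  have "Abs_fps (\<lambda>k. (1 - t ^ k) / of_nat k * power_sum 0 x k) = 0"
    by (rule fps_ext) (simp add: power_sum_def)
  then show ?thesis by (simp add: q_series_eq)
qed

lemma power_sum_Suc: "power_sum (Suc N) (case_nat z y) k = z ^ k + power_sum N y k"
  unfolding power_sum_def by (subst sum.lessThan_Suc_shift) simp

lemma q_series_Suc:
  "q_series (Suc N) (case_nat z y) t = (fps_exp 1 oo q_log t z) * q_series N y t"
proof -
  have "Abs_fps (\<lambda>k. (1 - t ^ k) / of_nat k * power_sum (Suc N) (case_nat z y) k) =
      q_log t z + Abs_fps (\<lambda>k. (1 - t ^ k) / of_nat k * power_sum N y k)"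
    by (rule fps_ext) (simp only: q_log_def power_sum_Suc fps_nth_Abs_fps fps_add_nth distrib_left)
  then show ?thesis
    by (simp add: q_series_eq fps_exp_compose_add q_log_def)
qed

text \<open>The product formula with factors \<open>(1 - t y_i X) / (1 - y_i X)\<close>, cleared of
  denominators; each variable contributes one factor by \<open>exp_q_log\<close>.\<close>

lemma q_series_prod:
  "q_series N y t * (\<Prod>i<N. linear_fps (y i)) = (\<Prod>i<N. linear_fps (t * y i))"
proof (induction N arbitrary: y)
  case (Suc N)
  have y: "y = case_nat (y 0) (y \<circ> Suc)" by (auto split: nat.split)
  have "q_series (Suc N) y t * (\<Prod>i<Suc N. linear_fps (y i)) =
      ((fps_exp 1 oo q_log t (y 0)) * linear_fps (y 0)) *
      (q_series N (y \<circ> Suc) t * (\<Prod>i<N. linear_fps ((y \<circ> Suc) i)))"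
    by (subst y, subst q_series_Suc, subst prod.lessThan_Suc_shift) (simp add: mult_ac)
  also have "\<dots> = linear_fps (t * y 0) * (\<Prod>i<N. linear_fps (t * (y \<circ> Suc) i))"
    by (simp only: exp_q_log Suc.IH)
  also have "\<dots> = (\<Prod>i<Suc N. linear_fps (t * y i))"
    by (subst prod.lessThan_Suc_shift) simp
  finally show ?case .
qed (simp add: q_series_0)

section \<open>Signed elementary symmetric polynomials\<close>

text \<open>\<open>(-1)\<^sup>k e\<^sub>k(y\<^sub>0, \<dots>, y\<^bsub>N-1\<^esub>)\<close>\<close>

definition signed_elem :: "nat \<Rightarrow> (nat \<Rightarrow> complex) \<Rightarrow> nat \<Rightarrow> complex" where
  "signed_elem N y k = fps_nth (\<Prod>i<N. linear_fps (y i)) k"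

text \<open>Scaling every \<open>y i\<close> by \<open>t\<close> amounts to substituting
  \<open>t X\<close> for \<open>X\<close>.\<close>

lemma signed_elem_scale: "fps_nth (\<Prod>i<N. linear_fps (t * y i)) k = t ^ k * signed_elem N y k"
proof -
  have "(\<Prod>i<N. linear_fps (t * y i)) = Abs_fps (\<lambda>k. t ^ k * signed_elem N y k)"
  proof (induction N)
    case 0
    show ?case by (rule fps_ext) (auto simp: signed_elem_def)
  next
    case (Suc N)
    show ?case
    proof (rule fps_ext)
      fix n
      show "fps_nth (\<Prod>i<Suc N. linear_fps (t * y i)) n =
          fps_nth (Abs_fps (\<lambda>k. t ^ k * signed_elem (Suc N) y k)) n"
        using Suc by (cases n) (simp_all add: signed_elem_def algebra_simps)
    qed
  qed
  then show ?thesis by simp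
qed

text \<open>The product of the \<open>1 - y_i X\<close> is the reversal of the product of the
  \<open>X - y_i\<close>.\<close>

lemma signed_elem_root_poly:
  "signed_elem N y k = (if k \<le> N then Polynomial.coeff (root_poly N y) (N - k) else 0)"
proof -
  have "fps_of_poly (reflect_poly (root_poly N y)) = (\<Prod>i<N. linear_fps (y i))"
  proof -
    have "fps_of_poly (reflect_poly [:- c, 1:]) = linear_fps c" for c :: complex
    proof (rule fps_ext)
      fix n show "fps_nth (fps_of_poly (reflect_poly [:- c, 1:])) n = fps_nth (linear_fps c) n"
        by (cases n; cases "n - 1") (auto simp: coeff_reflect_poly)
    qed
    then show ?thesis
      by (simp only: root_poly_def reflect_poly_prod fps_of_poly_prod)
  qed
  then have "signed_elem N y k = Polynomial.coeff (reflect_poly (root_poly N y)) k"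
    by (simp add: signed_elem_def flip: fps_of_poly_nth)
  then show ?thesis by (simp add: coeff_reflect_poly degree_root_poly)
qed

lemma q_fun_0 [simp]: "q_fun N y t 0 = 1"
  by (simp add: q_fun_def)

lemma signed_elem_0 [simp]: "signed_elem N y 0 = 1"
  using signed_elem_root_poly lead_coeff_root_poly by simp

text \<open>Comparison of the coefficients of \<open>X^k\<close> in \<open>q_series_prod\<close>;
  the term \<open>j = 0\<close> has moved to the left, whence the \<open>- 1\<close>.\<close>

lemma signed_elem_recursion:
  assumes "0 < k"
  shows "(t ^ k - 1) * signed_elem N y k = (\<Sum>j=1..k. q_fun N y t j * signed_elem N y (k - j))"
proof -
  have "t ^ k * signed_elem N y k = (\<Sum>j=0..k. q_fun N y t j * signed_elem N y (k - j))"
    using arg_cong[OF q_series_prod[of N y t], of "\<lambda>h. fps_nth h k"]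
    by (simp add: signed_elem_scale fps_mult_nth signed_elem_def q_series_def)
  also have "\<dots> = signed_elem N y k + (\<Sum>j=1..k. q_fun N y t j * signed_elem N y (k - j))"
    by (simp add: sum.atLeast_Suc_atMost)
  finally show ?thesis by (simp add: algebra_simps)
qed

section \<open>Brick tabloids\<close>

lemma finite_nonzero_lists_sum: "finite {b :: nat list. 0 \<notin> set b \<and> sum_list b = k}"
proof (rule finite_subset[OF _ finite_lists_length_le])
  show "{b :: nat list. 0 \<notin> set b \<and> sum_list b = k} \<subseteq> {b. set b \<subseteq> {..k} \<and> length b \<le> k}"
  proof (clarsimp, intro conjI subsetI)
    fix b :: "nat list" assume "0 \<notin> set b"
    then show "length b \<le> sum_list b" by (induction b) auto
  qed (simp add: member_le_sum_list)
qed simp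

lemma finite_partitions: "finite {lam. is_partition lam n}"
  by (rule finite_subset[OF _ finite_nonzero_lists_sum[of n]]) (auto simp: is_partition_def)

lemma brick_tabloids_nat:
  "brick_tabloids (int k) = {b. 0 \<notin> set b \<and> sum_list b = k}"
  by (simp add: brick_tabloids_def)

lemma brick_tabloids_0: "brick_tabloids 0 = {[]}"
proof -
  have "b \<in> brick_tabloids 0 \<longleftrightarrow> b = []" for b
    by (cases b) (auto simp: brick_tabloids_def)
  then show ?thesis by blast
qed

lemma finite_brick_tabloids: "finite (brick_tabloids m)"
  by (rule finite_subset[OF _ finite_nonzero_lists_sum[of "nat m"]]) (auto simp: brick_tabloids_def)

text \<open>The last brick is split off because the last partial sum is always \<open>k\<close>.\<close>

lemma brick_tabloids_snoc:
  assumes "0 < k"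
  shows "bij_betw (\<lambda>(j, b). b @ [j]) (SIGMA j:{1..k}. brick_tabloids (int (k - j))) (brick_tabloids (int k))"
proof (rule bij_betw_byWitness[where f' = "\<lambda>b. (last b, butlast b)"])
  have snoc: "\<exists>b' j. b = b' @ [j] \<and> j \<in> {1..k} \<and> 0 \<notin> set b' \<and> sum_list b' = k - j"
    if "b \<in> brick_tabloids (int k)" for b
    using that assms by (cases b rule: rev_cases) (auto simp: brick_tabloids_nat Suc_le_eq)
  show "\<forall>b\<in>brick_tabloids (int k). (\<lambda>(j, b). b @ [j]) (last b, butlast b) = b"
    using snoc by (metis (no_types, lifting) butlast_snoc case_prod_conv last_snoc)
  show "(\<lambda>b. (last b, butlast b)) ` brick_tabloids (int k) \<subseteq>
      (SIGMA j:{1..k}. brick_tabloids (int (k - j)))"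
  proof
    fix p assume "p \<in> (\<lambda>b. (last b, butlast b)) ` brick_tabloids (int k)"
    then obtain b where b: "b \<in> brick_tabloids (int k)" "p = (last b, butlast b)" by auto
    obtain b' j where "b = b' @ [j]" "j \<in> {1..k}" "0 \<notin> set b'" "sum_list b' = k - j"
      using snoc[OF b(1)] by blast
    then show "p \<in> (SIGMA j:{1..k}. brick_tabloids (int (k - j)))"
      by (simp add: b(2) brick_tabloids_nat)
  qed
qed (auto simp: brick_tabloids_nat)

text \<open>The recursion, solved for \<open>signed_elem N y k\<close> and iterated: its index
  \<open>j\<close> is the length of the last brick, and the divisor \<open>t ^ k - 1\<close> belongs
  to the last partial sum.\<close>

lemma signed_elem_brick_expansion:
  assumes "\<And>j. 1 \<le> j \<Longrightarrow> j \<le> k \<Longrightarrow> t ^ j \<noteq> 1"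
  shows "signed_elem N y k = (\<Sum>b\<in>brick_tabloids (int k).
    (\<Prod>j=1..length b. 1 / (t ^ brick_sum b j - 1)) * q_fun_prod N y t b)"
  using assms
proof (induction k rule: less_induct)
  case (less k)
  show ?case
  proof (cases "k = 0")
    case True
    then show ?thesis by (simp add: q_fun_prod_def brick_tabloids_0)
  next
    case False
    let ?w = "\<lambda>b. (\<Prod>j=1..length b. 1 / (t ^ brick_sum b j - 1)) * q_fun_prod N y t b"
    have w: "?w (b @ [j]) = ?w b * q_fun N y t j / (t ^ k - 1)"
      if "j \<in> {1..k}" "b \<in> brick_tabloids (int (k - j))" for j b
    proof -
      \<comment> \<open>Appending a brick leaves the earlier partial sums unchanged and adds the new
        one \<open>k\<close>.\<close>
      have "brick_sum (b @ [j]) (Suc (length b)) = k"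
        using that by (auto simp: brick_sum_def brick_tabloids_def)
      moreover have "(\<Prod>i=1..length b. 1 / (t ^ brick_sum (b @ [j]) i - 1)) =
          (\<Prod>i=1..length b. 1 / (t ^ brick_sum b i - 1))"
        by (intro prod.cong refl) (simp add: brick_sum_def)
      ultimately show ?thesis by (simp add: q_fun_prod_def)
    qed
    have "(\<Sum>b\<in>brick_tabloids (int k). ?w b) =
        (\<Sum>(j, b)\<in>(SIGMA j:{1..k}. brick_tabloids (int (k - j))). ?w (b @ [j]))"
      using False by (subst sum.reindex_bij_betw[OF brick_tabloids_snoc, symmetric])
        (auto simp: case_prod_unfold)
    also have "\<dots> = (\<Sum>j=1..k. \<Sum>b\<in>brick_tabloids (int (k - j)). ?w (b @ [j]))"
      by (rule sum.Sigma[symmetric]) (auto simp: finite_brick_tabloids)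
    also have "\<dots> = (\<Sum>j=1..k. \<Sum>b\<in>brick_tabloids (int (k - j)). ?w b * q_fun N y t j / (t ^ k - 1))"
      by (intro sum.cong refl w)
    also have "\<dots> = (\<Sum>j=1..k. signed_elem N y (k - j) * q_fun N y t j / (t ^ k - 1))"
    proof (rule sum.cong[OF refl])
      fix j assume j: "j \<in> {1..k}"
      have "signed_elem N y (k - j) = (\<Sum>b\<in>brick_tabloids (int (k - j)). ?w b)"
        using j less.prems by (intro less.IH) auto
      then show "(\<Sum>b\<in>brick_tabloids (int (k - j)). ?w b * q_fun N y t j / (t ^ k - 1)) =
          signed_elem N y (k - j) * q_fun N y t j / (t ^ k - 1)"
        by (simp only: sum_distrib_right sum_divide_distrib)
    qed
    also have "\<dots> = (\<Sum>j=1..k. q_fun N y t j * signed_elem N y (k - j)) / (t ^ k - 1)"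
      by (simp only: sum_divide_distrib mult.commute)
    also have "\<dots> = signed_elem N y k"
      using False less.prems[of k] by (subst signed_elem_recursion[symmetric]) auto
    finally show ?thesis by simp
  qed
qed

section \<open>Splitting off one variable\<close>

text \<open>For \<open>k > 0\<close> the coefficient of \<open>(1 - t c X) / (1 - c X)\<close> is
  \<open>c^k - t c c^(k-1)\<close>.\<close>

lemma exp_q_log_nth: "fps_nth (fps_exp 1 oo q_log t c) k = (if k = 0 then 1 else (1 - t) * c ^ k)"
proof -
  have "fps_exp 1 oo q_log t c = ((fps_exp 1 oo q_log t c) * linear_fps c) * Abs_fps (\<lambda>k. c ^ k)"
    using linear_fps_geometric[of c] by (simp only: mult.assoc) simp
  also have "\<dots> = linear_fps (t * c) * Abs_fps (\<lambda>k. c ^ k)" by (simp only: exp_q_log)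
  finally have eq: "fps_exp 1 oo q_log t c = linear_fps (t * c) * Abs_fps (\<lambda>k. c ^ k)" .
  show ?thesis
    unfolding eq by (cases k) (simp_all add: left_diff_distrib mult.assoc fps_X_mult_nth)
qed

lemma q_fun_Suc:
  "q_fun (Suc N) (case_nat z y) t k =
    (\<Sum>j\<le>k. (if j = 0 then 1 else 1 - t) * z ^ j * q_fun N y t (k - j))"
  using arg_cong[OF q_series_Suc[of N z y t], of "\<lambda>h. fps_nth h k"]
  by (simp add: q_series_def fps_mult_nth exp_q_log_nth atLeast0AtMost if_distrib cong: if_cong)
     (auto intro!: sum.cong)

lemma index_set_Nil: "index_set [] = {[]}"
  by (auto simp: index_set_def)

lemma index_set_Cons: "index_set (m # mu) = (\<lambda>(j, tau). j # tau) ` ({..m} \<times> index_set mu)"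
proof (intro equalityI subsetI)
  fix tau assume tau: "tau \<in> index_set (m # mu)"
  then obtain j tau' where "tau = j # tau'" by (cases tau) (auto simp: index_set_def)
  moreover have "j \<le> m" "tau' \<in> index_set mu"
    using tau calculation by (auto simp: index_set_def All_less_Suc2)
  ultimately show "tau \<in> (\<lambda>(j, tau). j # tau) ` ({..m} \<times> index_set mu)" by auto
qed (auto simp: index_set_def All_less_Suc2)

text \<open>Each entry of \<open>tau\<close> records the power of \<open>z\<close> taken from the
  corresponding factor; every nonzero entry brings one factor \<open>1 - t\<close>.\<close>

lemma q_fun_prod_Suc:
  "q_fun_prod (Suc N) (case_nat z y) t mu =
    (\<Sum>tau\<in>index_set mu. (1 - t) ^ num_nonzero tau * z ^ sum_list tau * q_fun_prod N y t (comp_diff mu tau))"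
proof (induction mu)
  case Nil
  show ?case by (simp add: index_set_Nil q_fun_prod_def comp_diff_def num_nonzero_def)
next
  case (Cons m mu)
  have inj: "inj_on (\<lambda>(j, tau). j # tau) ({..m} \<times> index_set mu)" by (auto simp: inj_on_def)
  have "q_fun_prod (Suc N) (case_nat z y) t (m # mu) =
      q_fun (Suc N) (case_nat z y) t m * q_fun_prod (Suc N) (case_nat z y) t mu"
    by (simp add: q_fun_prod_def)
  also have "\<dots> = (\<Sum>j\<le>m. \<Sum>tau\<in>index_set mu.
     ((if j = 0 then 1 else 1 - t) * z ^ j * q_fun N y t (m - j)) *
     ((1 - t) ^ num_nonzero tau * z ^ sum_list tau * q_fun_prod N y t (comp_diff mu tau)))"
    by (simp only: q_fun_Suc Cons.IH sum_product)
  also have "\<dots> = (\<Sum>(j, tau)\<in>{..m} \<times> index_set mu.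
     ((if j = 0 then 1 else 1 - t) * z ^ j * q_fun N y t (m - j)) *
     ((1 - t) ^ num_nonzero tau * z ^ sum_list tau * q_fun_prod N y t (comp_diff mu tau)))"
    by (rule sum.cartesian_product)
  also have "\<dots> = (\<Sum>tau\<in>index_set (m # mu).
     (1 - t) ^ num_nonzero tau * z ^ sum_list tau * q_fun_prod N y t (comp_diff (m # mu) tau))"
    unfolding index_set_Cons
    by (subst sum.reindex[OF inj])
       (auto intro!: sum.cong simp: num_nonzero_def comp_diff_def q_fun_prod_def power_add)
  finally show ?case .
qed

lemma q_fun_prod_append: "q_fun_prod N x t (a @ b) = q_fun_prod N x t a * q_fun_prod N x t b"
  by (simp add: q_fun_prod_def)

text \<open>The product is commutative, and zero entries contribute
  \<open>q_fun N x t 0 = 1\<close>.\<close>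

lemma q_fun_prod_partition_of_parts: "q_fun_prod N x t (partition_of_parts a) = q_fun_prod N x t a"
proof -
  have "q_fun_prod N x t (partition_of_parts a) =
      prod_mset (image_mset (q_fun N x t) (mset (partition_of_parts a)))"
    by (simp only: q_fun_prod_def prod_mset_prod_list[symmetric] mset_map)
  also have "mset (partition_of_parts a) = mset (filter (\<lambda>k. k \<noteq> 0) a)"
    by (simp add: partition_of_parts_def)
  also have "prod_mset (image_mset (q_fun N x t) \<dots>) = q_fun_prod N x t (filter (\<lambda>k. k \<noteq> 0) a)"
    by (simp only: q_fun_prod_def prod_mset_prod_list[symmetric] mset_map)
  also have "\<dots> = q_fun_prod N x t a"
    by (induction a) (auto simp: q_fun_prod_def)
  finally show ?thesis .
qed

section \<open>Character values\<close>

text \<open>The exponents \<lambda> + \<delta> of the numerator of a Schur polynomial, as a list of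
  fixed length so that exponents can be compared by equality.\<close>

definition shifted_parts :: "nat \<Rightarrow> nat list \<Rightarrow> nat list" where
  "shifted_parts N lam = map (\<lambda>j. nth_default 0 lam j + (N - 1 - j)) [0..<N]"

lemma length_shifted_parts [simp]: "length (shifted_parts N lam) = N"
  by (simp add: shifted_parts_def)

lemma shifted_parts_nth: "j < N \<Longrightarrow> shifted_parts N lam ! j = nth_default 0 lam j + (N - 1 - j)"
  by (simp add: shifted_parts_def)

lemma nth_default_partition_antimono:
  assumes "is_partition lam n" "i \<le> j"
  shows "nth_default 0 lam j \<le> nth_default 0 lam i"
proof (cases "i = j \<or> length lam \<le> j")
  case False
  then have "i < j" "j < length lam" using assms(2) by auto
  then show ?thesis
    using assms(1) by (auto simp: is_partition_def sorted_wrt_iff_nth_less nth_default_def)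
qed (auto simp: nth_default_def)

lemma shifted_parts_decreasing:
  assumes "is_partition lam n" "i < j" "j < N"
  shows "shifted_parts N lam ! j < shifted_parts N lam ! i"
  using nth_default_partition_antimono[OF assms(1), of i j] assms(2,3)
  by (simp add: shifted_parts_nth)

lemma sorted_shifted_parts: "is_partition lam n \<Longrightarrow> sorted_wrt (>) (shifted_parts N lam)"
  by (simp add: sorted_wrt_iff_nth_less shifted_parts_decreasing)

lemma length_partition_le: "is_partition lam n \<Longrightarrow> length lam \<le> n"
proof -
  have "0 \<notin> set b \<Longrightarrow> length b \<le> sum_list b" for b :: "nat list" by (induction b) auto
  then show "is_partition lam n \<Longrightarrow> length lam \<le> n" by (auto simp: is_partition_def)
qed

text \<open>Since \<open>N\<close> bounds both sizes, no part lies beyond position \<open>N\<close>;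
  lists without trailing zeros are determined by their entries padded with 0.\<close>

lemma shifted_parts_inject:
  assumes "is_partition lam n" "is_partition nu m" "n \<le> N" "m \<le> N"
    and "shifted_parts N lam = shifted_parts N nu"
  shows "lam = nu"
proof -
  have "nth_default 0 lam j = nth_default 0 nu j" for j
  proof (cases "j < N")
    case True
    then show ?thesis using arg_cong[OF assms(5), of "\<lambda>a. a ! j"] by (simp add: shifted_parts_nth)
  next
    case False
    then show ?thesis
      using length_partition_le[OF assms(1)] length_partition_le[OF assms(2)] assms(3,4)
      by (simp add: nth_default_def)
  qed
  then have "nth_default 0 lam = nth_default 0 nu" by (rule ext)
  moreover have "no_trailing ((=) 0) b" if "0 \<notin> set b" for b :: "nat list"
    using that by (metis last_in_set no_trailing_unfold)
  then have "no_trailing ((=) 0) lam" "no_trailing ((=) 0) nu"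
    using assms(1,2) by (simp_all add: is_partition_def)
  ultimately show ?thesis by (simp add: nth_default_eq_iff)
qed

lemma alternant_shifted_parts:
  "alternant N ((!) (shifted_parts N lam)) x = alternant N (\<lambda>j. nth_default 0 lam j + (N - 1 - j)) x"
  by (rule alternant_cong) (simp_all add: shifted_parts_nth)

section \<open>The Frobenius formula in terms of alternants\<close>

text \<open>Unlike the formula with Schur functions, this holds at all points: both sides vanish when
  two coordinates coincide. This is what allows comparing coefficients below.\<close>

lemma frobenius_alternant:
  assumes "frobenius_formula m q R" "is_partition mu m" "m \<le> N"
  shows "q ^ m / (q - 1) ^ length mu * q_fun_prod N x (inverse q) mu * alternant N (\<lambda>j. N - 1 - j) x =
    (\<Sum>lam | is_partition lam m. hecke_char m q R lam mu * alternant N ((!) (shifted_parts N lam)) x)"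
proof (cases "inj_on x {..<N}")
  case True
  let ?\<delta> = "alternant N (\<lambda>j. N - 1 - j) x"
  have "q ^ m / (q - 1) ^ length mu * q_fun_prod N x (inverse q) mu =
      (\<Sum>lam | is_partition lam m. hecke_char m q R lam mu * schur N lam x)"
    using assms(1,2) True by (simp add: frobenius_formula_def)
  moreover have "schur N lam x * ?\<delta> = alternant N ((!) (shifted_parts N lam)) x"
    if "is_partition lam m" for lam
  proof -
    \<comment> \<open>With at least \<open>m\<close> variables the default value 0 of
      \<open>schur\<close> does not occur.\<close>
    have "length lam \<le> N" using length_partition_le[OF that] assms(3) by simp
    then have "schur N lam x = alternant N ((!) (shifted_parts N lam)) x / ?\<delta>"
      by (simp only: schur_def alternant_shifted_parts if_True)
    then show ?thesis using vandermonde_nonzero[OF True] by (metis nonzero_eq_divide_eq)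
  qed
  ultimately show ?thesis
    by (simp add: sum_distrib_right mult.assoc)
qed (simp add: alternant_eq_0_if_not_inj)

lemma is_partition_partition_of_parts: "is_partition (partition_of_parts a) (sum_list a)"
proof -
  have "sum_list (partition_of_parts a) = sum_list (filter (\<lambda>k. k \<noteq> 0) a)"
    by (simp add: partition_of_parts_def flip: sum_mset_sum_list)
  also have "\<dots> = sum_list a" by (induction a) auto
  finally show ?thesis
    by (simp add: is_partition_def partition_of_parts_def sorted_wrt_rev)
qed

lemma length_partition_of_parts: "length (partition_of_parts a) = num_nonzero a"
  by (simp add: partition_of_parts_def num_nonzero_def)

lemma sum_list_comp_diff:
  assumes "tau \<in> index_set mu"
  shows "sum_list tau \<le> sum_list mu" "sum_list (comp_diff mu tau) = sum_list mu - sum_list tau"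
proof -
  have "sum_list tau \<le> sum_list mu \<and> sum_list (comp_diff mu tau) = sum_list mu - sum_list tau"
    using assms
  proof (induction mu arbitrary: tau)
    case (Cons m mu)
    then obtain j tau' where tau: "tau = j # tau'" "j \<le> m" "tau' \<in> index_set mu"
      by (auto simp: index_set_Cons)
    then show ?case using Cons.IH[OF tau(3)] by (simp add: comp_diff_def)
  qed (simp add: index_set_Nil comp_diff_def)
  then show "sum_list tau \<le> sum_list mu" "sum_list (comp_diff mu tau) = sum_list mu - sum_list tau"
    by auto
qed

lemma is_partition_tl:
  assumes "is_partition lam n"
  shows "is_partition (tl lam) (n - nth_default 0 lam 0)"
  using assms by (cases lam) (auto simp: is_partition_def)

text \<open>Both sides are the coefficient of \<open>z\<close> to the power \<open>k + n\<close> in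
  the formula for the variables \<open>z, y\<close>. The shift by \<open>n\<close> is the degree of
  \<open>root_poly n y\<close>, whose coefficients are the \<open>signed_elem\<close>.\<close>

lemma frobenius_coefficient:
  assumes frob: "frobenius_formula n q R" and mu: "is_partition mu n"
  shows "q ^ n / (q - 1) ^ length mu * alternant n (\<lambda>j. n - 1 - j) y *
      (\<Sum>tau\<in>index_set mu. (1 - inverse q) ^ num_nonzero tau * q_fun_prod n y (inverse q) (comp_diff mu tau) *
         (if k \<le> sum_list tau then signed_elem n y (sum_list tau - k) else 0)) =
    (\<Sum>lam | is_partition lam n. hecke_char n q R lam mu *
       (\<Sum>j | j \<le> n \<and> shifted_parts (Suc n) lam ! j = k + n.
          (-1) ^ j * alternant n ((!) (shifted_parts (Suc n) lam) \<circ> skip_index j) y))"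
proof -
  define c where "c = q ^ n / (q - 1) ^ length mu * alternant n (\<lambda>j. n - 1 - j) y"
  define w where "w tau = (1 - inverse q) ^ num_nonzero tau * q_fun_prod n y (inverse q) (comp_diff mu tau)" for tau
  define L where "L = Polynomial.smult c
    (\<Sum>tau\<in>index_set mu. Polynomial.monom (w tau) (sum_list tau) * root_poly n y)"
  define P where "P = (\<Sum>lam | is_partition lam n.
    Polynomial.smult (hecke_char n q R lam mu) (alternant_poly n ((!) (shifted_parts (Suc n) lam)) y))"
  have "poly L z = poly P z" for z
  proof -
    have "alternant (Suc n) (\<lambda>j. Suc n - 1 - j) (case_nat z y) =
        alternant n (\<lambda>j. n - 1 - j) y * poly (root_poly n y) z"
      using poly_alternant_poly[of n "\<lambda>j. n - j" y z] by (simp add: vandermonde_poly)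
    moreover have "q_fun_prod (Suc n) (case_nat z y) (inverse q) mu =
        (\<Sum>tau\<in>index_set mu. w tau * z ^ sum_list tau)"
      by (simp add: q_fun_prod_Suc w_def mult_ac)
    moreover have "poly L z = c * ((\<Sum>tau\<in>index_set mu. w tau * z ^ sum_list tau) * poly (root_poly n y) z)"
      by (simp add: L_def poly_sum poly_monom sum_distrib_right)
    ultimately have "poly L z = q ^ n / (q - 1) ^ length mu *
        q_fun_prod (Suc n) (case_nat z y) (inverse q) mu *
        alternant (Suc n) (\<lambda>j. Suc n - 1 - j) (case_nat z y)"
      by (simp only: c_def mult_ac)
    also have "\<dots> = poly P z"
      by (subst frobenius_alternant[OF frob mu]) (simp_all add: P_def poly_sum poly_alternant_poly)
    finally show ?thesis .
  qed
  then have "L = P" by (simp add: poly_eq_poly_eq_iff[symmetric] fun_eq_iff)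
  then have "Polynomial.coeff L (k + n) = Polynomial.coeff P (k + n)" by simp
  also have "Polynomial.coeff P (k + n) = (\<Sum>lam | is_partition lam n. hecke_char n q R lam mu *
       (\<Sum>j | j \<le> n \<and> shifted_parts (Suc n) lam ! j = k + n.
          (-1) ^ j * alternant n ((!) (shifted_parts (Suc n) lam) \<circ> skip_index j) y))"
    by (simp add: P_def Polynomial.coeff_sum coeff_alternant_poly)
  also have "Polynomial.coeff L (k + n) = c * (\<Sum>tau\<in>index_set mu. w tau *
      (if k \<le> sum_list tau then signed_elem n y (sum_list tau - k) else 0))"
  proof -
    have "Polynomial.coeff (Polynomial.monom (w tau) (sum_list tau) * root_poly n y) (k + n) =
        w tau * (if k \<le> sum_list tau then signed_elem n y (sum_list tau - k) else 0)"
      if "tau \<in> index_set mu" for tau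
    proof -
      have s: "sum_list tau \<le> n"
        using sum_list_comp_diff(1)[OF that] mu by (simp add: is_partition_def)
      show ?thesis
      proof (cases "k \<le> sum_list tau")
        case True
        then have "k + n - sum_list tau = n - (sum_list tau - k)" by simp
        then show ?thesis using True s by (simp add: coeff_monom_mult signed_elem_root_poly)
      next
        case False
        \<comment> \<open>Here the exponent exceeds the degree \<open>n\<close>.\<close>
        then have "Polynomial.coeff (root_poly n y) (k + n - sum_list tau) = 0"
          by (intro coeff_eq_0) (simp add: degree_root_poly)
        then show ?thesis using False by (simp add: coeff_monom_mult)
      qed
    qed
    then show ?thesis by (simp add: L_def Polynomial.coeff_sum)
  qed
  finally show ?thesis by (simp only: c_def w_def)
qed

section \<open>The right-hand side of the rule\<close>

definition brick_weight :: "complex \<Rightarrow> nat list \<Rightarrow> complex" where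
  "brick_weight q b = (\<Prod>j=1..length b. 1 / (q powi (- int (brick_sum b j)) - 1))"

text \<open>The character of the smaller algebra is replaced by a function \<open>chi\<close>, in
  which the expression is linear; \<open>k\<close> stands for the first part of the
  partition.\<close>

definition dual_MN_rhs :: "complex \<Rightarrow> nat \<Rightarrow> (nat list \<Rightarrow> complex) \<Rightarrow> nat list \<Rightarrow> complex" where
  "dual_MN_rhs q k chi mu = (\<Sum>tau \<in> index_set mu.
     q powi (int k - int (num_nonzero tau)) *
     (\<Sum>b \<in> brick_tabloids (int (sum_list tau) - int k).
        (q - 1) powi (int (num_nonzero tau) - int (length mu)
                      + int (num_nonzero (comp_diff mu tau)) + int (length b)) *
        brick_weight q b * chi (partition_of_parts (comp_diff mu tau @ b))))"

lemma brick_weight_inverse: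
  "brick_weight q b = (\<Prod>j=1..length b. 1 / (inverse q ^ brick_sum b j - 1))"
  by (simp add: brick_weight_def power_int_minus power_inverse)

text \<open>Linearity in \<open>chi\<close>: the sum over \<kappa> moves innermost, where the
  Frobenius formula can evaluate it.\<close>

lemma dual_MN_rhs_sum:
  assumes "finite K"
  shows "(\<Sum>\<kappa>\<in>K. dual_MN_rhs q k (chi \<kappa>) mu * a \<kappa>) =
    (\<Sum>tau \<in> index_set mu. \<Sum>b \<in> brick_tabloids (int (sum_list tau) - int k).
      q powi (int k - int (num_nonzero tau)) *
      ((q - 1) powi (int (num_nonzero tau) - int (length mu)
                      + int (num_nonzero (comp_diff mu tau)) + int (length b)) *
        brick_weight q b * (\<Sum>\<kappa>\<in>K. chi \<kappa> (partition_of_parts (comp_diff mu tau @ b)) * a \<kappa>)))"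
proof -
  have "(\<Sum>\<kappa>\<in>K. dual_MN_rhs q k (chi \<kappa>) mu * a \<kappa>) =
    (\<Sum>\<kappa>\<in>K. \<Sum>tau \<in> index_set mu. \<Sum>b \<in> brick_tabloids (int (sum_list tau) - int k).
      q powi (int k - int (num_nonzero tau)) *
      ((q - 1) powi (int (num_nonzero tau) - int (length mu)
                      + int (num_nonzero (comp_diff mu tau)) + int (length b)) *
        brick_weight q b * (chi \<kappa> (partition_of_parts (comp_diff mu tau @ b)) * a \<kappa>)))"
    by (simp add: dual_MN_rhs_def sum_distrib_left sum_distrib_right mult.assoc)
  also have "\<dots> = (\<Sum>tau \<in> index_set mu. \<Sum>b \<in> brick_tabloids (int (sum_list tau) - int k). \<Sum>\<kappa>\<in>K.
      q powi (int k - int (num_nonzero tau)) *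
      ((q - 1) powi (int (num_nonzero tau) - int (length mu)
                      + int (num_nonzero (comp_diff mu tau)) + int (length b)) *
        brick_weight q b * (chi \<kappa> (partition_of_parts (comp_diff mu tau @ b)) * a \<kappa>)))"
    by (subst sum.swap, rule sum.cong[OF refl], rule sum.swap)
  finally show ?thesis by (simp add: sum_distrib_left)
qed

text \<open>Expanding \<open>signed_elem\<close> over brick tabloids \<b> turns each summand into a
  product of \<open>q_fun\<close> over a partition of \<open>n - k\<close>, to which the Frobenius
  formula for \<open>n - k\<close> applies.\<close>

lemma dual_MN_rhs_alternant:
  assumes q: "q \<noteq> 0" "\<And>j. 1 \<le> j \<Longrightarrow> j \<le> n \<Longrightarrow> q ^ j \<noteq> 1" and n: "0 < n"
    and frob: "frobenius_formula (n - k) q R" and mu: "is_partition mu n" and k: "k \<le> n"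
  shows "q ^ n / (q - 1) ^ length mu * alternant n (\<lambda>j. n - 1 - j) y *
      (\<Sum>tau\<in>index_set mu. (1 - inverse q) ^ num_nonzero tau * q_fun_prod n y (inverse q) (comp_diff mu tau) *
         (if k \<le> sum_list tau then signed_elem n y (sum_list tau - k) else 0)) =
    (\<Sum>\<kappa> | is_partition \<kappa> (n - k). dual_MN_rhs q k (hecke_char (n - k) q R \<kappa>) mu *
       alternant n ((!) (shifted_parts n \<kappa>)) y)" (is "?c * ?\<delta> * _ = _")
proof -
  have q1: "q \<noteq> 1" using q(2)[of 1] n by simp
  have coef: "?c * ?\<delta> * ((1 - inverse q) ^ num_nonzero tau * q_fun_prod n y (inverse q) (comp_diff mu tau) *
         (if k \<le> sum_list tau then signed_elem n y (sum_list tau - k) else 0)) =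
      (\<Sum>b \<in> brick_tabloids (int (sum_list tau) - int k).
        q powi (int k - int (num_nonzero tau)) *
        ((q - 1) powi (int (num_nonzero tau) - int (length mu)
                      + int (num_nonzero (comp_diff mu tau)) + int (length b)) *
        brick_weight q b * (\<Sum>\<kappa> | is_partition \<kappa> (n - k).
          hecke_char (n - k) q R \<kappa> (partition_of_parts (comp_diff mu tau @ b)) *
          alternant n ((!) (shifted_parts n \<kappa>)) y)))"
    if tau: "tau \<in> index_set mu" for tau
  proof (cases "k \<le> sum_list tau")
    case False
    \<comment> \<open>There are no tabloids of negative size, so both sides vanish.\<close>
    then have "brick_tabloids (int (sum_list tau) - int k) = {}" by (auto simp: brick_tabloids_def)
    then show ?thesis using False by simp
  next
    case True
    define s where "s = sum_list tau - k"
    have s: "int (sum_list tau) - int k = int s" using True by (simp add: s_def)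
    have sn: "sum_list tau \<le> n" using sum_list_comp_diff(1)[OF tau] mu by (simp add: is_partition_def)
    have "inverse q ^ j \<noteq> 1" if "1 \<le> j" "j \<le> s" for j
      using q(2)[of j] that sn by (simp add: s_def power_inverse)
    then have expand: "signed_elem n y s =
        (\<Sum>b\<in>brick_tabloids (int s). brick_weight q b * q_fun_prod n y (inverse q) b)"
      unfolding brick_weight_inverse by (rule signed_elem_brick_expansion)
    have term_eq: "?c * ?\<delta> * ((1 - inverse q) ^ num_nonzero tau * q_fun_prod n y (inverse q) (comp_diff mu tau) *
        (brick_weight q b * q_fun_prod n y (inverse q) b)) =
        q powi (int k - int (num_nonzero tau)) *
        ((q - 1) powi (int (num_nonzero tau) - int (length mu)
                      + int (num_nonzero (comp_diff mu tau)) + int (length b)) *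
        brick_weight q b * (\<Sum>\<kappa> | is_partition \<kappa> (n - k).
          hecke_char (n - k) q R \<kappa> (partition_of_parts (comp_diff mu tau @ b)) *
          alternant n ((!) (shifted_parts n \<kappa>)) y))"
      if b: "b \<in> brick_tabloids (int s)" for b
    proof -
      define \<nu> where "\<nu> = partition_of_parts (comp_diff mu tau @ b)"
      have "sum_list b = sum_list tau - k" using b by (simp add: brick_tabloids_nat s_def)
      then have "sum_list (comp_diff mu tau @ b) = n - k"
        using sum_list_comp_diff(2)[OF tau] mu True sn by (simp add: is_partition_def)
      then have \<nu>: "is_partition \<nu> (n - k)"
        using is_partition_partition_of_parts[of "comp_diff mu tau @ b"] by (simp add: \<nu>_def)
      have "0 \<notin> set b" using b by (simp add: brick_tabloids_def)
      then have "filter (\<lambda>k. k \<noteq> 0) b = b" by (intro filter_True) metis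
      then have len: "length \<nu> = num_nonzero (comp_diff mu tau) + length b"
        by (simp add: \<nu>_def length_partition_of_parts num_nonzero_def)
      define F where "F = q_fun_prod n y (inverse q) \<nu> * ?\<delta>"
      have F: "q_fun_prod n y (inverse q) (comp_diff mu tau) * q_fun_prod n y (inverse q) b * ?\<delta> = F"
        by (simp only: F_def \<nu>_def q_fun_prod_partition_of_parts q_fun_prod_append)
      have frob': "(\<Sum>\<kappa> | is_partition \<kappa> (n - k). hecke_char (n - k) q R \<kappa> \<nu> *
          alternant n ((!) (shifted_parts n \<kappa>)) y) = q ^ (n - k) / (q - 1) ^ length \<nu> * F"
        using frobenius_alternant[OF frob \<nu>, of n y] by (simp add: F_def mult_ac)
      \<comment> \<open>Each nonzero entry of \<open>tau\<close> contributes
        \<open>1 - 1/q = (q - 1) / q\<close>. Splitting off the prefactor of the Frobenius formula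
        for \<nu> leaves exactly the powers of \<open>q\<close> and \<open>q - 1\<close> in the
        rule.\<close>
      have scalar: "?c * (1 - inverse q) ^ num_nonzero tau =
          q powi (int k - int (num_nonzero tau)) *
          (q - 1) powi (int (num_nonzero tau) - int (length mu)
                      + int (num_nonzero (comp_diff mu tau)) + int (length b)) *
          (q ^ (n - k) / (q - 1) ^ length \<nu>)"
      proof -
        have "1 - inverse q = (q - 1) / q" using q(1) by (simp add: field_simps)
        moreover have "q ^ n = q ^ (n - k) * q ^ k" using k by (simp flip: power_add)
        ultimately show ?thesis
          using q(1) q1
          by (simp add: power_int_diff power_int_add power_divide len power_add field_simps)
      qed
      have "?c * ?\<delta> * ((1 - inverse q) ^ num_nonzero tau * q_fun_prod n y (inverse q) (comp_diff mu tau) *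
        (brick_weight q b * q_fun_prod n y (inverse q) b)) =
        (?c * (1 - inverse q) ^ num_nonzero tau) * brick_weight q b *
        (q_fun_prod n y (inverse q) (comp_diff mu tau) * q_fun_prod n y (inverse q) b * ?\<delta>)"
        by (simp only: mult_ac)
      then show ?thesis
        unfolding F scalar frob'[unfolded \<nu>_def] unfolding \<nu>_def[symmetric] by (simp only: mult_ac)
    qed
    show ?thesis
      unfolding s
      by (simp only: True if_True s_def[symmetric] expand sum_distrib_left term_eq cong: sum.cong)
  qed
  show ?thesis
    by (subst dual_MN_rhs_sum, rule finite_partitions)
       (simp only: sum_distrib_left coef cong: sum.cong)
qed

section \<open>Comparison of coefficients\<close>

lemma shifted_parts_tl:
  assumes "j < N"
  shows "shifted_parts N (tl lam) ! j = shifted_parts (Suc N) lam ! Suc j"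
  using assms by (cases lam) (simp_all add: shifted_parts_nth)

text \<open>The coefficient in question has two expansions in alternants of \<open>n\<close>
  variables, by \<open>frobenius_coefficient\<close> and by \<open>dual_MN_rhs_alternant\<close>;
  the coefficients of the alternant of \<open>tl lam\<close> are compared.\<close>

lemma character_recursion:
  assumes q: "q \<noteq> 0" "\<And>j. 1 \<le> j \<Longrightarrow> j \<le> n \<Longrightarrow> q ^ j \<noteq> 1" and n: "0 < n"
    and frob: "frobenius_formula n q R" "frobenius_formula (n - nth_default 0 lam 0) q R'"
    and lam: "is_partition lam n" and mu: "is_partition mu n"
  shows "hecke_char n q R lam mu =
    dual_MN_rhs q (nth_default 0 lam 0) (hecke_char (n - nth_default 0 lam 0) q R' (tl lam)) mu"
proof -
  define k where "k = nth_default 0 lam 0"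
  have k: "k \<le> n"
    using lam by (cases lam) (auto simp: is_partition_def k_def)
  \<comment> \<open>A pair consists of a partition and a column whose exponent is
    \<open>k + n\<close>; \<open>e\<close> lists the exponents left after deleting that
    column.\<close>
  define I where "I = (SIGMA \<eta>:{\<eta>. is_partition \<eta> n}. {j. j \<le> n \<and> shifted_parts (Suc n) \<eta> ! j = k + n})"
  define e where "e = (\<lambda>(\<eta>, j). map ((!) (shifted_parts (Suc n) \<eta>) \<circ> skip_index j) [0..<n])"
  define a where "a = shifted_parts n (tl lam)"
  define J where "J = {\<kappa>. is_partition \<kappa> (n - k)}"
  have tl: "is_partition (tl lam) (n - k)" using is_partition_tl[OF lam] by (simp add: k_def)
  have finI: "finite I" unfolding I_def by (intro finite_SigmaI finite_partitions) simp
  have e: "length (e i) = n \<and> sorted_wrt (>) (e i)" if "i \<in> I" for i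
  proof -
    obtain \<eta> j where i: "i = (\<eta>, j)" "is_partition \<eta> n" using \<open>i \<in> I\<close> by (auto simp: I_def)
    have "shifted_parts (Suc n) \<eta> ! skip_index j v < shifted_parts (Suc n) \<eta> ! skip_index j u"
      if "u < v" "v < n" for u v
      by (rule shifted_parts_decreasing[OF i(2)]) (use that in \<open>auto simp: skip_index_def\<close>)
    then show ?thesis by (simp add: e_def i(1) sorted_wrt_iff_nth_less)
  qed
  have "(\<Sum>i | i \<in> I \<and> e i = a. (case i of (\<eta>, j) \<Rightarrow> hecke_char n q R \<eta> mu * (-1) ^ j)) =
      (\<Sum>\<kappa> | \<kappa> \<in> J \<and> shifted_parts n \<kappa> = a. dual_MN_rhs q k (hecke_char (n - k) q R' \<kappa>) mu)"
  proof (rule alternant_families_coeff_eq[where N = n, OF finI _ e])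
    show "finite J" unfolding J_def by (rule finite_partitions)
    fix y
    have "(\<Sum>i\<in>I. (case i of (\<eta>, j) \<Rightarrow> hecke_char n q R \<eta> mu * (-1) ^ j) * alternant n ((!) (e i)) y) =
      (\<Sum>(\<eta>, j)\<in>I. hecke_char n q R \<eta> mu *
          ((-1) ^ j * alternant n ((!) (shifted_parts (Suc n) \<eta>) \<circ> skip_index j) y))"
    proof (rule sum.cong[OF refl], clarify)
      fix \<eta> j
      have "alternant n ((!) (e (\<eta>, j))) y =
          alternant n ((!) (shifted_parts (Suc n) \<eta>) \<circ> skip_index j) y"
        by (rule alternant_cong) (simp_all add: e_def)
      then show "hecke_char n q R \<eta> mu * (- 1) ^ j * alternant n ((!) (e (\<eta>, j))) y =
          hecke_char n q R \<eta> mu *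
          ((- 1) ^ j * alternant n ((!) (shifted_parts (Suc n) \<eta>) \<circ> skip_index j) y)"
        by (simp only: mult.assoc)
    qed
    also have "\<dots> = (\<Sum>\<eta> | is_partition \<eta> n. hecke_char n q R \<eta> mu *
       (\<Sum>j | j \<le> n \<and> shifted_parts (Suc n) \<eta> ! j = k + n.
          (-1) ^ j * alternant n ((!) (shifted_parts (Suc n) \<eta>) \<circ> skip_index j) y))"
      unfolding I_def sum_distrib_left by (rule sum.Sigma[symmetric]) (simp_all add: finite_partitions)
    also have "\<dots> = (\<Sum>\<kappa>\<in>J. dual_MN_rhs q k (hecke_char (n - k) q R' \<kappa>) mu *
        alternant n ((!) (shifted_parts n \<kappa>)) y)"
      unfolding J_def
      using frobenius_coefficient[OF frob(1) mu, of y k]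
        dual_MN_rhs_alternant[OF q n frob(2)[folded k_def] mu k, of y] by simp
    finally show "(\<Sum>i\<in>I. (case i of (\<eta>, j) \<Rightarrow> hecke_char n q R \<eta> mu * (-1) ^ j) * alternant n ((!) (e i)) y) =
        (\<Sum>\<kappa>\<in>J. dual_MN_rhs q k (hecke_char (n - k) q R' \<kappa>) mu * alternant n ((!) (shifted_parts n \<kappa>)) y)" .
  qed (auto simp: J_def intro: sorted_shifted_parts)
  moreover have "{\<kappa>. \<kappa> \<in> J \<and> shifted_parts n \<kappa> = a} = {tl lam}"
    using tl shifted_parts_inject[of _ "n - k" "tl lam" "n - k" n] by (auto simp: J_def a_def)
  \<comment> \<open>So the left-hand sum is the single term of \<open>lam\<close>, with sign
    \<open>(-1) ^ 0\<close>.\<close>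
  moreover have "{i. i \<in> I \<and> e i = a} = {(lam, 0)}"
  proof (intro equalityI subsetI)
    fix i assume "i \<in> {i. i \<in> I \<and> e i = a}"
    then obtain \<eta> j where i: "i = (\<eta>, j)" "is_partition \<eta> n" "j \<le> n"
      "shifted_parts (Suc n) \<eta> ! j = k + n" "e (\<eta>, j) = a" by (auto simp: I_def)
    have ea: "shifted_parts (Suc n) \<eta> ! skip_index j u = shifted_parts (Suc n) lam ! Suc u"
      if "u < n" for u
      using that arg_cong[OF i(5), of "\<lambda>b. b ! u"] by (simp add: e_def a_def shifted_parts_tl)
    have lam0: "shifted_parts (Suc n) lam ! 0 = k + n" by (simp add: shifted_parts_nth k_def)
    \<comment> \<open>Deleting a later row would leave a first exponent larger than \<open>k + n\<close>, whereas the first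
      exponent of \<open>a\<close> is smaller than \<open>k + n\<close>.\<close>
    have "j = 0"
    proof (rule ccontr)
      assume j: "j \<noteq> 0"
      have "k + n < shifted_parts (Suc n) \<eta> ! 0"
        using shifted_parts_decreasing[OF i(2), of 0 j "Suc n"] j i(3,4) by simp
      also have "\<dots> = shifted_parts (Suc n) lam ! Suc 0"
        using ea[of 0] j n by (simp add: skip_index_def)
      also have "\<dots> < k + n"
        using shifted_parts_decreasing[OF lam, of 0 "Suc 0" "Suc n"] n lam0 by simp
      finally show False .
    qed
    have "shifted_parts (Suc n) \<eta> = shifted_parts (Suc n) lam"
    proof (rule nth_equalityI)
      fix u assume "u < length (shifted_parts (Suc n) \<eta>)"
      then show "shifted_parts (Suc n) \<eta> ! u = shifted_parts (Suc n) lam ! u"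
        using \<open>j = 0\<close> i(4) lam0 ea[of "u - 1"] by (cases u) (simp_all add: skip_index_def)
    qed simp
    then have "\<eta> = lam" using shifted_parts_inject[OF i(2) lam, of "Suc n"] by simp
    with \<open>j = 0\<close> show "i \<in> {(lam, 0)}" by (simp add: i(1))
  next
    fix i assume "i \<in> {(lam, 0 :: nat)}"
    then have i: "i = (lam, 0)" by simp
    have "e i = a"
      unfolding a_def by (rule nth_equalityI) (simp_all add: e_def i skip_index_def shifted_parts_tl)
    then show "i \<in> {i. i \<in> I \<and> e i = a}"
      using lam by (simp add: I_def i shifted_parts_nth k_def)
  qed
  ultimately show ?thesis by (simp add: k_def)
qed

theorem theorem3p4:
  fixes q :: complex and n :: nat and lam mu :: "nat list"
    and R :: "nat \<Rightarrow> nat list \<Rightarrow> hecke_elem \<Rightarrow> complex mat"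
  assumes "q \<noteq> 0" and "\<And>k. 1 \<le> k \<Longrightarrow> k \<le> n \<Longrightarrow> q ^ k \<noteq> 1"
    and "\<And>m. m \<le> n \<Longrightarrow> irrep_labeling m q (R m)"
    and "is_partition lam n" and "is_partition mu n"
  shows "hecke_char n q (R n) lam mu =
    (\<Sum>tau \<in> index_set mu.
       q powi (int (nth_default 0 lam 0) - int (num_nonzero tau)) *
       (\<Sum>b \<in> brick_tabloids (int (sum_list tau) - int (nth_default 0 lam 0)).
          (q - 1) powi (int (num_nonzero tau) - int (length mu)
                        + int (num_nonzero (comp_diff mu tau)) + int (length b)) *
          (\<Prod>j = 1..length b. 1 / (q powi (- int (brick_sum b j)) - 1)) *
          hecke_char (n - nth_default 0 lam 0) q (R (n - nth_default 0 lam 0)) (tl lam)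
            (partition_of_parts (comp_diff mu tau @ b))))"
proof (cases "n = 0")
  case True
  \<comment> \<open>For \<open>n = 0\<close> the assumption on powers of \<open>q\<close> is vacuous
    and \<open>q = 1\<close> is possible. The only summand has empty \<open>tau\<close> and empty
    tabloid, and both sides are the same character value.\<close>
  then have "lam = []" "mu = []"
    using length_partition_le[OF assms(4)] length_partition_le[OF assms(5)] by auto
  then show ?thesis
    by (simp add: True index_set_Nil num_nonzero_def comp_diff_def brick_tabloids_0 partition_of_parts_def)
next
  case False
  have "frobenius_formula m q (R m)" if "m \<le> n" for m
    using assms(3)[OF that] by (simp add: irrep_labeling_def)
  then show ?thesis
    using character_recursion[of q n "R n" lam "R (n - nth_default 0 lam 0)" mu] assms False
    by (simp add: dual_MN_rhs_def brick_weight_def)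
qed

end
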